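(* Let $(k,\alpha)\in\Upsilon$. If $u\in\operatorname{rext}(L_{k,\alpha})$ and $v\in\operatorname{lext}(L_{k,\alpha})$, then there exists a word $w\in L_{k,\alpha}$ such that $uwv\in L_{k,\alpha}$.
   Context: $\Sigma_k$ is an alphabet with $k$ letters. For a nonempty finite word $r$ and a rational $\beta\ge 1$ with $\beta|r|$ an integer, the $\beta$-power $r^\beta$ is the word $rr\cdots rt$ of length $\beta|r|$, where $t$ is a prefix of $r$ (e.g. $(1234)^{7/4}=1234123$). For rational $\alpha\ge1$, a finite or infinite word is $\alpha$-power free if it has no factor that is a $\beta$-power (of some nonempty word) with $\beta\ge\alpha$, and $\alpha^+$-power free if it has no factor that is a $\beta$-power with $\beta>\alpha$. Below "$\alpha$" may denote either a rational number or a symbol $\alpha^+$ ("number with $+$"), and "$\alpha$-power free" is interpreted accordingly. $L_{k,\alpha}\subseteq\Sigma_k^*$ is the set of finite $\alpha$-power free words over $\Sigma_k$. $\Upsilon$ is the set of pairs consisting of: $(k,\alpha)$ with $k=3$ and rational $\alpha>2$; $(k,\alpha)$ with $k>3$ and rational $\alpha\ge2$; and $(k,\alpha^+)$ with $k\ge3$ and rational $\alpha\ge2$. For a language $L\subseteq\Sigma_k^*$, a word $w\in L$ is left (resp. right) extendable in $L$ if for every $n\in\mathbb N$ there is $u\in L$ with $|u|=n$ and $uw\in L$ (resp. $wu\in L$). $\operatorname{lext}(L)$ (resp. $\operatorname{rext}(L)$) is the set of left (resp. right) extendable words of $L$. *)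

theory Defs
  imports Main "HOL.Rat"
begin

definition alphabet :: "nat \<Rightarrow> nat set" where
  "alphabet k = {0..<k}"

text \<open>x is a beta-power of the nonempty word r, with beta = |x|/|r| >= 1:
  x = r r ... r t with t a prefix of r.\<close>
definition is_power_of :: "nat list \<Rightarrow> nat list \<Rightarrow> bool" where
  "is_power_of r x \<longleftrightarrow> r \<noteq> [] \<and> length r \<le> length x \<and>
     x = take (length x) (concat (replicate (length x) r))"

definition power_exp :: "nat list \<Rightarrow> nat list \<Rightarrow> rat" where
  "power_exp r x = of_nat (length x) / of_nat (length r)"

definition is_factor :: "'a list \<Rightarrow> 'a list \<Rightarrow> bool" where
  "is_factor x w \<longleftrightarrow> (\<exists>a b. w = a @ x @ b)"

text \<open>An exponent is a pair (alpha, plus): plus = False means the rational alpha,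
  plus = True means the symbol alpha^+.\<close>
definition exceeds :: "rat \<times> bool \<Rightarrow> rat \<Rightarrow> bool" where
  "exceeds A \<beta> \<longleftrightarrow> (if snd A then \<beta> > fst A else \<beta> \<ge> fst A)"

definition power_free :: "rat \<times> bool \<Rightarrow> nat list \<Rightarrow> bool" where
  "power_free A w \<longleftrightarrow>
     (\<forall>x r. is_factor x w \<and> is_power_of r x \<longrightarrow> \<not> exceeds A (power_exp r x))"

definition L :: "nat \<Rightarrow> rat \<times> bool \<Rightarrow> nat list set" where
  "L k A = {w. set w \<subseteq> alphabet k \<and> power_free A w}"

definition Upsilon :: "(nat \<times> (rat \<times> bool)) set" where
  "Upsilon = {(k, (a, p)). (k = 3 \<and> a > 2 \<and> \<not> p) \<or> (k > 3 \<and> a \<ge> 2 \<and> \<not> p)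
                          \<or> (k \<ge> 3 \<and> a \<ge> 2 \<and> p)}"

definition lext :: "nat list set \<Rightarrow> nat list set" where
  "lext M = {w \<in> M. \<forall>n::nat. \<exists>u \<in> M. length u = n \<and> u @ w \<in> M}"

definition rext :: "nat list set \<Rightarrow> nat list set" where
  "rext M = {w \<in> M. \<forall>n::nat. \<exists>u \<in> M. length u = n \<and> w @ u \<in> M}"

end

theory Submission
  imports Defs "HOL-Library.Sublist" "HOL-Library.Infinite_Set" "HOL-Combinatorics.Transposition"
begin

text \<open>
  Extend u to a right-infinite power free word in which some letter x recurs, and let T be an
  infinite power free word without x.  If the grafted word P T, with P ending in x, contains a
  power of exponent at least 2 and period p across the junction, then its part after the last x is
  shorter than p, so that x followed by some prefix of T already occurred p positions earlier.
  Cutting at the first occurrence of x followed by a long enough prefix of T, or else after a late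
  occurrence of x followed by the longest prefix of T that recurs after x, rules this out.
  The same applies to the reversal of v, with the same x
  (a first grafting makes a recurrent letter of one side recurrent on the other), and with a
  word R all of whose reversed prefixes are factors of T.  The two grafted words then meet in a
  factor of T that is too long to lie between two occurrences of x in a square.
  Words without x come from the Thue--Morse word and from its square free difference word.
\<close>

section \<open>Powers by positions\<close>

text \<open>No root word appears, only a window and a period, so that one predicate serves lists,
  infinite words and words pieced together from several functions.\<close>

definition power_at :: "rat \<times> bool \<Rightarrow> (nat \<Rightarrow> 'a) \<Rightarrow> nat \<Rightarrow> nat \<Rightarrow> nat \<Rightarrow> bool" where
  "power_at A f i l p \<longleftrightarrow> 0 < p \<and> p \<le> l \<and> (\<forall>n. i \<le> n \<longrightarrow> n + p < i + l \<longrightarrow> f n = f (n + p))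
     \<and> exceeds A (of_nat l / of_nat p)"

definition pfree :: "rat \<times> bool \<Rightarrow> (nat \<Rightarrow> 'a) \<Rightarrow> nat \<Rightarrow> bool" where
  "pfree A f N \<longleftrightarrow> (\<forall>i l p. i + l \<le> N \<longrightarrow> \<not> power_at A f i l p)"

lemma power_at_shift:
  assumes "power_at A g i l p" "s \<le> i"
    and "\<And>n. i \<le> n \<Longrightarrow> n < i + l \<Longrightarrow> g n = f (n - s)"
  shows "power_at A f (i - s) l p"
  unfolding power_at_def
proof (intro conjI allI impI)
  fix n assume n: "i - s \<le> n" "n + p < i - s + l"
  have "g (n + s) = g (n + s + p)"
    using assms(1) n \<open>s \<le> i\<close> unfolding power_at_def by (auto dest!: spec[of _ "n + s"])
  moreover have "g (n + s) = f n" using assms(3)[of "n + s"] n assms(2) by simp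
  moreover have "g (n + s + p) = f (n + p)" using assms(3)[of "n + s + p"] n assms(2)
    by (simp add: algebra_simps)
  ultimately show "f n = f (n + p)" by simp
qed (use assms(1) in \<open>auto simp: power_at_def\<close>)

lemma power_at_cong:
  assumes "power_at A g i l p" and "\<And>n. i \<le> n \<Longrightarrow> n < i + l \<Longrightarrow> g n = f n"
  shows "power_at A f i l p"
  using power_at_shift[OF assms(1), of 0 f] assms(2) unfolding diff_zero by blast

text \<open>Periods survive reversal. The mirror image \<open>c - (i + l - 1)\<close> of the last
  position becomes the new start.\<close>

lemma power_at_reflect:
  assumes "power_at A g i l p" "i + l \<le> Suc c"
    and "\<And>n. i \<le> n \<Longrightarrow> n < i + l \<Longrightarrow> g n = f (c - n)"
  shows "power_at A f (Suc c - i - l) l p"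
  unfolding power_at_def
proof (intro conjI allI impI)
  fix n assume n: "Suc c - i - l \<le> n" "n + p < Suc c - i - l + l"
  define m where "m = c - n - p"
  have m: "i \<le> m" "m + p < i + l" "c - m = n + p" "c - (m + p) = n"
    using n assms(2) by (auto simp: m_def)
  have "g m = g (m + p)" using assms(1) m unfolding power_at_def by blast
  then show "f n = f (n + p)" using assms(3)[of m] assms(3)[of "m + p"] m by simp
qed (use assms(1) in \<open>auto simp: power_at_def\<close>)

lemma pfree_cong:
  assumes "pfree A f N" and "\<And>n. n < N \<Longrightarrow> f n = g n"
  shows "pfree A g N"
  unfolding pfree_def
proof (intro allI impI notI)
  fix i l p assume "i + l \<le> N" "power_at A g i l p"
  have "power_at A f i l p"
  proof (rule power_at_cong[OF \<open>power_at A g i l p\<close>])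
    show "g n = f n" if "n < i + l" for n
      using assms(2)[of n] that \<open>i + l \<le> N\<close> by simp
  qed
  then show False using \<open>i + l \<le> N\<close> assms(1) unfolding pfree_def by blast
qed

lemma pfree_inj_image:
  assumes "pfree A f N" and "inj_on h (range f)"
  shows "pfree A (h \<circ> f) N"
proof -
  have "(h \<circ> f) m = (h \<circ> f) n \<longleftrightarrow> f m = f n" for m n
    using inj_on_eq_iff[OF assms(2), of "f m" "f n"] by simp
  then show ?thesis using assms(1) unfolding pfree_def power_at_def by presburger
qed

section \<open>From powers of lists to powers by positions\<close>

lemma nth_concat_replicate:
  "i < n * length r \<Longrightarrow> concat (replicate n r) ! i = r ! (i mod length r)"
proof (induction n arbitrary: i)
  case (Suc n)
  show ?case
  proof (cases "i < length r")
    case False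
    then have "concat (replicate n r) ! (i - length r) = r ! ((i - length r) mod length r)"
      using Suc by (intro Suc.IH) auto
    then show ?thesis using False by (simp add: nth_append le_mod_geq)
  qed (simp add: nth_append)
qed simp

lemma is_power_of_iff_nth:
  "is_power_of r x \<longleftrightarrow> r \<noteq> [] \<and> length r \<le> length x \<and> (\<forall>i<length x. x ! i = r ! (i mod length r))"
proof (cases "r = []")
  case False
  then have le: "length x \<le> length x * length r" by (cases r) auto
  define c where "c = concat (replicate (length x) r)"
  have "length (take (length x) c) = length x"
    using le by (simp add: c_def length_concat sum_list_replicate)
  moreover have "c ! i = r ! (i mod length r)" if "i < length x" for i
    unfolding c_def by (rule nth_concat_replicate[OF less_le_trans[OF that le]])
  ultimately have "x = take (length x) c \<longleftrightarrow> (\<forall>i<length x. x ! i = r ! (i mod length r))"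
    unfolding list_eq_iff_nth_eq by simp
  then have "x = take (length x) (concat (replicate (length x) r))
     \<longleftrightarrow> (\<forall>i<length x. x ! i = r ! (i mod length r))"
    unfolding c_def .
  then show ?thesis unfolding is_power_of_def by blast
qed (simp add: is_power_of_def)

text \<open>A window of period \<open>p\<close> is a power of its first \<open>p\<close> letters;
  conversely the length of the root is a period of the power.\<close>

lemma power_free_iff_pfree: "power_free A w \<longleftrightarrow> pfree A ((!) w) (length w)"
proof
  assume w: "power_free A w"
  show "pfree A ((!) w) (length w)"
    unfolding pfree_def
  proof (intro allI impI notI)
    fix i l p assume il: "i + l \<le> length w" and P: "power_at A ((!) w) i l p"
    define x where "x = take l (drop i w)"
    have p: "0 < p" "p \<le> l" using P by (auto simp: power_at_def)
    have len: "length x = l" using il by (simp add: x_def)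
    have xn: "x ! n = w ! (i + n)" if "n < l" for n using that il by (simp add: x_def)
    have per: "x ! n = x ! (n mod p)" if "n < l" for n
      using that
    proof (induction n rule: less_induct)
      case (less n)
      show ?case
      proof (cases "n < p")
        case False
        then have "w ! (i + (n - p)) = w ! (i + (n - p) + p)"
          using P less.prems unfolding power_at_def by auto
        then have "x ! (n - p) = x ! n" using False less.prems by (simp add: xn)
        then show ?thesis using less.IH[of "n - p"] less.prems False p
          by (simp add: le_mod_geq)
      qed simp
    qed
    have "is_power_of (take p x) x"
      unfolding is_power_of_iff_nth using p len per by auto
    moreover have "is_factor x w"
    proof -
      have "w = take i w @ x @ drop l (drop i w)" unfolding x_def by (simp only: append_take_drop_id)
      then show ?thesis unfolding is_factor_def by blast
    qed
    moreover have "exceeds A (power_exp (take p x) x)"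
    proof -
      have "length (take p x) = p" using p len by simp
      then show ?thesis using P len by (simp only: power_exp_def power_at_def)
    qed
    ultimately show False using w unfolding power_free_def by blast
  qed
next
  assume f: "pfree A ((!) w) (length w)"
  show "power_free A w"
    unfolding power_free_def
  proof (intro allI impI notI, elim conjE)
    fix x r assume "is_factor x w" and r: "is_power_of r x" and e: "exceeds A (power_exp r x)"
    then obtain a b where w: "w = a @ x @ b" unfolding is_factor_def by blast
    have "power_at A ((!) w) (length a) (length x) (length r)"
      unfolding power_at_def
    proof (intro conjI allI impI)
      fix n assume n: "length a \<le> n" "n + length r < length a + length x"
      define m where "m = n - length a"
      have m: "n = length a + m" "m + length r < length x" using n by (auto simp: m_def)
      then have "x ! m = x ! (m + length r)" using r unfolding is_power_of_iff_nth by simp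
      then show "w ! n = w ! (n + length r)" using m by (simp add: w nth_append)
    qed (use r e in \<open>auto simp: is_power_of_def power_exp_def\<close>)
    then show False using f unfolding pfree_def w by auto
  qed
qed

lemma mem_L_iff: "w \<in> L k A \<longleftrightarrow> (\<forall>n<length w. w ! n < k) \<and> pfree A ((!) w) (length w)"
proof -
  have "set w \<subseteq> alphabet k \<longleftrightarrow> (\<forall>a\<in>set w. a < k)" by (auto simp: alphabet_def)
  then show ?thesis
    unfolding L_def power_free_iff_pfree mem_Collect_eq by (simp only: all_set_conv_all_nth)
qed

lemma map_upt_mem_L_iff: "map f [0..<N] \<in> L k A \<longleftrightarrow> (\<forall>n<N. f n < k) \<and> pfree A f N"
proof -
  have "pfree A ((!) (map f [0..<N])) N \<longleftrightarrow> pfree A f N"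
  proof
    show "pfree A f N" if "pfree A ((!) (map f [0..<N])) N"
      by (rule pfree_cong[OF that]) simp
    show "pfree A ((!) (map f [0..<N])) N" if "pfree A f N"
      by (rule pfree_cong[OF that]) simp
  qed
  then show ?thesis by (simp add: mem_L_iff)
qed

lemma rev_mem_L: "w \<in> L k A \<Longrightarrow> rev w \<in> L k A"
proof -
  assume w: "w \<in> L k A"
  have "pfree A ((!) (rev w)) (length w)"
    unfolding pfree_def
  proof (intro allI impI notI)
    fix i l p assume *: "i + l \<le> length w" "power_at A ((!) (rev w)) i l p"
    then have "0 < l" by (auto simp: power_at_def)
    then have "power_at A ((!) w) (Suc (length w - 1) - i - l) l p"
      using * by (intro power_at_reflect[OF *(2)]) (auto simp: rev_nth)
    then show False using w * \<open>0 < l\<close> unfolding mem_L_iff pfree_def by auto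
  qed
  then show ?thesis using w by (simp add: L_def power_free_iff_pfree)
qed

lemma factor_mem_L: "a @ w @ b \<in> L k A \<Longrightarrow> w \<in> L k A"
  by (auto simp: L_def power_free_def is_factor_def) (metis append.assoc)

lemma rev_mem_rext:
  assumes "v \<in> lext (L k A)" shows "rev v \<in> rext (L k A)"
  unfolding rext_def
proof (intro CollectI conjI allI)
  show "rev v \<in> L k A" using assms by (simp add: lext_def rev_mem_L)
  fix n
  obtain u where u: "u \<in> L k A" "length u = n" "u @ v \<in> L k A"
    using assms unfolding lext_def by blast
  then show "\<exists>u\<in>L k A. length u = n \<and> rev v @ u \<in> L k A"
    using rev_mem_L[of u] rev_mem_L[of "u @ v"] by (intro bexI[of _ "rev u"]) auto
qed

section \<open>Infinite words by compactness\<close>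

text \<open>Koenig's lemma: the words satisfying \<open>Q\<close> form an infinite, finitely
  branching tree, and an infinite branch spells \<open>f\<close>.\<close>

lemma konig_words:
  fixes Q :: "nat list \<Rightarrow> bool"
  assumes prefix_closed: "\<And>xs ys. Q (xs @ ys) \<Longrightarrow> Q xs"
    and long: "\<And>n. \<exists>w. Q w \<and> length w = n"
    and bounded: "\<And>w. Q w \<Longrightarrow> set w \<subseteq> {..<k}"
  shows "\<exists>f. \<forall>n. Q (map f [0..<n])"
proof -
  \<comment> \<open>Apart from \<open>w\<close> itself, the subtree \<open>E w\<close> splits into
    the subtrees of finitely many words \<open>w @ [a]\<close>, so one of these is infinite whenever
    \<open>E w\<close> is.\<close>
  define E where "E w = {w'. Q w' \<and> prefix w w'}" for w
  have step: "\<exists>a. infinite (E (w @ [a]))" if inf: "infinite (E w)" for w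
  proof (rule ccontr)
    assume "\<not> ?thesis"
    then have "finite ({w} \<union> (\<Union>a<k. E (w @ [a])))" by simp
    moreover have "E w \<subseteq> {w} \<union> (\<Union>a<k. E (w @ [a]))"
    proof
      fix w' assume w': "w' \<in> E w"
      then obtain zs where zs: "w' = w @ zs" by (auto simp: E_def prefix_def)
      show "w' \<in> {w} \<union> (\<Union>a<k. E (w @ [a]))"
      proof (cases zs)
        case (Cons a as)
        then show ?thesis using w' bounded[of w'] zs by (auto simp: E_def)
      qed (use zs in simp)
    qed
    ultimately show False using inf finite_subset by blast
  qed
  define g where "g = rec_nat [] (\<lambda>_ w. w @ [SOME a. infinite (E (w @ [a]))])"
  define f where "f n = (SOME a. infinite (E (g n @ [a])))" for n
  have g: "g 0 = []" "g (Suc n) = g n @ [f n]" for n by (auto simp: g_def f_def)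
  have gf: "g n = map f [0..<n]" for n by (induction n) (auto simp: g)
  have "infinite (E [])"
  proof
    assume "finite (E [])"
    then have "finite (length ` E [])" by blast
    moreover have "n \<in> length ` E []" for n using long[of n] unfolding E_def by auto
    then have "length ` E [] = UNIV" by blast
    ultimately show False by simp
  qed
  then have inf_g: "infinite (E (g n))" for n
  proof (induction n)
    case (Suc n)
    then show ?case using someI_ex[OF step[OF Suc.IH]] by (simp add: g f_def)
  qed (simp add: g)
  have "Q (g n)" for n
  proof -
    have "E (g n) \<noteq> {}" using inf_g[of n] by force
    then obtain zs where "Q (g n @ zs)" unfolding E_def prefix_def by auto
    then show ?thesis by (rule prefix_closed)
  qed
  then show ?thesis using gf by auto
qed

lemma infinite_extension:
  assumes "u \<in> rext (L k A)"
  obtains U where "\<And>n. U n < k" "\<And>N. pfree A U N" "\<And>n. n < length u \<Longrightarrow> U n = u ! n"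
proof -
  \<comment> \<open>The minimum admits words that are still prefixes of \<open>u\<close>; this makes
    \<open>Q\<close> closed under prefixes.\<close>
  define Q where "Q w \<longleftrightarrow> w \<in> L k A \<and> (\<forall>n<min (length w) (length u). w ! n = u ! n)" for w
  have "\<exists>f. \<forall>n. Q (map f [0..<n])"
  proof (rule konig_words)
    fix xs ys assume "Q (xs @ ys)"
    then show "Q xs" using factor_mem_L[of "[]" xs ys] by (auto simp: Q_def nth_append split: if_splits)
  next
    fix n
    obtain w where w: "u @ w \<in> L k A" "length w = n" using assms unfolding rext_def by blast
    have "take n (u @ w) \<in> L k A"
      using factor_mem_L[of "[]" "take n (u @ w)" "drop n (u @ w)" k A] w
      by (metis append_Nil append_take_drop_id)
    then have "Q (take n (u @ w))" using w by (auto simp: Q_def nth_append)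
    then show "\<exists>w. Q w \<and> length w = n" using w by (intro exI[of _ "take n (u @ w)"]) auto
  next
    fix w assume "Q w" then show "set w \<subseteq> {..<k}" by (auto simp: Q_def L_def alphabet_def)
  qed
  then obtain f where f: "\<And>n. Q (map f [0..<n])" by blast
  show thesis
  proof (rule that[of f])
    show "f n < k" for n using f[of "Suc n"] unfolding Q_def map_upt_mem_L_iff by auto
    show "pfree A f N" for N using f[of N] unfolding Q_def map_upt_mem_L_iff by auto
    show "f n = u ! n" if "n < length u" for n using f[of "Suc n"] that
      by (auto simp: Q_def simp del: upt_Suc)
  qed
qed

text \<open>Reversing an infinite word leaves no first letter. Compactness supplies a substitute,
  applied to the words whose reversals are factors of \<open>T\<close>.\<close>

lemma reversed_limit_word:
  fixes T :: "nat \<Rightarrow> nat"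
  assumes "\<And>n. T n < k"
  obtains R where "\<And>K. \<exists>e. \<forall>n<K. T (e + n) = R (K - 1 - n)"
proof -
  define Q where "Q w \<longleftrightarrow> (\<exists>e. \<forall>n<length w. T (e + n) = w ! (length w - 1 - n))" for w
  have "\<exists>f. \<forall>n. Q (map f [0..<n])"
  proof (rule konig_words)
    fix xs ys assume "Q (xs @ ys)"
    then obtain e where e: "\<And>n. n < length (xs @ ys) \<Longrightarrow>
        T (e + n) = (xs @ ys) ! (length (xs @ ys) - 1 - n)"
      unfolding Q_def by blast
    \<comment> \<open>Under reversal \<open>ys\<close> comes first, so dropping it moves the
      occurrence in \<open>T\<close> to the right by its length.\<close>
    have "T (e + length ys + n) = xs ! (length xs - 1 - n)" if "n < length xs" for n
      using e[of "length ys + n"] that by (auto simp: nth_append add.assoc)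
    then show "Q xs" unfolding Q_def by blast
  next
    fix n
    have "Q (map (\<lambda>i. T (n - 1 - i)) [0..<n])" unfolding Q_def by (rule exI[of _ 0]) auto
    then show "\<exists>w. Q w \<and> length w = n" by (intro exI) auto
  next
    fix w assume "Q w"
    then obtain e where e: "\<And>n. n < length w \<Longrightarrow> T (e + n) = w ! (length w - 1 - n)"
      unfolding Q_def by blast
    have "w ! i < k" if "i < length w" for i
      using e[of "length w - 1 - i"] that assms[of "e + (length w - 1 - i)"] by simp
    then show "set w \<subseteq> {..<k}" by (auto simp: set_conv_nth)
  qed
  then obtain f where f: "\<And>n. Q (map f [0..<n])" by blast
  have "\<exists>e. \<forall>n<K. T (e + n) = f (K - 1 - n)" for K
    using f[of K] unfolding Q_def by auto
  then show thesis by (rule that)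
qed

section \<open>Recurrent letters\<close>

definition recurrent :: "'a \<Rightarrow> (nat \<Rightarrow> 'a) \<Rightarrow> bool" where
  "recurrent x f \<longleftrightarrow> (\<forall>N. \<exists>n\<ge>N. f n = x)"

lemma ex_recurrent:
  fixes f :: "nat \<Rightarrow> nat"
  assumes "\<And>n. f n < k"
  shows "\<exists>x<k. recurrent x f"
proof -
  have "finite (range f)" by (rule finite_subset[of _ "{..<k}"]) (use assms in auto)
  then obtain m where m: "infinite {n. f n = f m}"
    using pigeonhole_infinite[of UNIV f] by fastforce
  have "recurrent (f m) f"
    using m unfolding recurrent_def infinite_nat_iff_unbounded_le mem_Collect_eq .
  then show ?thesis using assms[of m] by blast
qed

section \<open>Grafting and joining\<close>

text \<open>The cut \<open>a\<close> may lie before \<open>N\<close>; the first letters of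
  \<open>T\<close> then agree with those of \<open>U\<close> up to \<open>N\<close>.\<close>

lemma graft:
  assumes A: "\<And>\<beta>. exceeds A \<beta> \<Longrightarrow> 2 \<le> \<beta>"
    and U: "\<And>M. pfree A U M" and rec: "recurrent x U"
    and T: "\<And>M. pfree A T M" and Tx: "\<And>n. T n \<noteq> x"
  obtains F a where "\<And>M. pfree A F M" "\<And>n. n < N \<Longrightarrow> F n = U n"
    "F a = x" "\<And>n. F (a + 1 + n) = T n" "\<And>n. n \<le> a \<Longrightarrow> F n = U n"
proof -
  note graft_exists = that
  \<comment> \<open>\<open>occ m j\<close> marks an \<open>x\<close> in \<open>U\<close> after which
    \<open>U\<close> happens to read the first \<open>m\<close> letters of \<open>T\<close>; cutting
    there changes nothing up to position \<open>j + m\<close>.\<close>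
  define occ where "occ m j \<longleftrightarrow> U j = x \<and> (\<forall>n<m. U (j + 1 + n) = T n)" for m j
  define F where "F j n = (if n \<le> j then U n else T (n - j - 1))" for j n
  have agree: "F j n = U n" if "occ m j" "n \<le> j + m" for j m n
  proof (cases "n \<le> j")
    case False
    then show ?thesis using that unfolding occ_def F_def
      by (auto dest!: spec[of _ "n - j - 1"])
  qed (simp add: F_def)
  \<comment> \<open>A power in \<open>F j\<close> must end beyond \<open>j + m\<close>, or it would
    lie in \<open>U\<close>, and start by \<open>j\<close>, or it would lie in \<open>T\<close>. One
    period earlier it shows a longer match with \<open>T\<close>.\<close>
  have crossing: "\<exists>p. 0 < p \<and> p \<le> j \<and> occ (Suc m) (j - p)
      \<and> (\<forall>D. j - p < D \<longrightarrow> D \<le> j \<longrightarrow> U D = x \<longrightarrow> p \<le> D)"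
    if o: "occ m j" and nf: "\<not> pfree A (F j) M" for m j M
  proof -
    obtain i l p where P: "power_at A (F j) i l p" using nf unfolding pfree_def by blast
    have p: "0 < p" "p \<le> l" using P by (auto simp: power_at_def)
    have per: "F j n = F j (n + p)" if "i \<le> n" "n + p < i + l" for n
      using P that unfolding power_at_def by blast
    have "2 \<le> (of_nat l / of_nat p :: rat)" using P A unfolding power_at_def by blast
    then have "of_nat (2 * p) \<le> (of_nat l :: rat)" using p by (simp add: field_simps)
    then have l: "2 * p \<le> l" by (simp only: of_nat_le_iff)
    have "j + 1 + m < i + l"
    proof (rule ccontr)
      assume "\<not> ?thesis"
      then have "power_at A U i l p" by (intro power_at_cong[OF P] agree[OF o]) auto
      then show False using U[of "i + l"] unfolding pfree_def by blast
    qed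
    have "i \<le> j"
    proof (rule ccontr)
      assume "\<not> ?thesis"
      then have "power_at A T (i - (j + 1)) l p" by (intro power_at_shift[OF P]) (auto simp: F_def)
      then show False using T[of "i - (j + 1) + l"] unfolding pfree_def by blast
    qed
    \<comment> \<open>If the window contained \<open>D + p\<close>, the letter \<open>x\<close> at
      \<open>D\<close> would recur there, inside the part taken from \<open>T\<close>.\<close>
    have short: "i + l \<le> D + p" if "i \<le> D" "D \<le> j" "j < D + p" "U D = x" for D
    proof (rule ccontr)
      assume "\<not> ?thesis"
      then have "F j D = F j (D + p)" using per that by simp
      then have "T (D + p - j - 1) = x" using that by (simp add: F_def)
      then show False using Tx by blast
    qed
    \<comment> \<open>With \<open>D = j\<close> the window ends by \<open>j + p\<close>; having
      length at least \<open>2 * p\<close>, it starts by \<open>j - p\<close>.\<close>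
    have "i + p \<le> j" using short[of j] \<open>i \<le> j\<close> o p l unfolding occ_def by simp
    have "U (j - p) = x"
      using per[of "j - p"] \<open>i + p \<le> j\<close> \<open>j + 1 + m < i + l\<close> o by (simp add: F_def occ_def)
    moreover have "U (j - p + 1 + n) = T n" if "n \<le> m" for n
    proof -
      have "F j (j - p + 1 + n) = F j (j + 1 + n)"
        using per[of "j - p + 1 + n"] \<open>i + p \<le> j\<close> \<open>j + 1 + m < i + l\<close> that
        by (simp add: algebra_simps)
      moreover have "F j (j - p + 1 + n) = U (j - p + 1 + n)"
        using \<open>i + p \<le> j\<close> that p by (intro agree[OF o]) auto
      ultimately show ?thesis by (simp add: F_def)
    qed
    ultimately have "occ (Suc m) (j - p)" unfolding occ_def by auto
    moreover have "p \<le> D" if "j - p < D" "D \<le> j" "U D = x" for D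
      using short[of D] that \<open>i + p \<le> j\<close> l by linarith
    ultimately show ?thesis using p \<open>i + p \<le> j\<close> by (intro exI[of _ p]) auto
  qed
  have finish: thesis if o: "occ m j" "N \<le> j + m" and free: "\<And>M. pfree A (F j) M" for m j
  proof (rule graft_exists[of "F j" j])
    show "F j n = U n" if "n < N" for n using agree[OF o(1)] o(2) that by simp
    show "F j j = x" using o(1) by (simp add: F_def occ_def)
  qed (use free in \<open>auto simp: F_def\<close>)
  show thesis
  proof (cases "\<exists>j. occ N j")
    case True
    define j where "j = (LEAST j. occ N j)"
    have j: "occ N j" unfolding j_def using True by (rule LeastI_ex)
    have "pfree A (F j) M" for M
    proof (rule ccontr)
      assume "\<not> ?thesis"
      then obtain p where "0 < p" "p \<le> j" "occ (Suc N) (j - p)" using crossing[OF j] by blast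
      then have "occ N (j - p)" "j - p < j" by (auto simp: occ_def)
      then show False unfolding j_def using not_less_Least by blast
    qed
    then show thesis using finish[OF j] by simp
  next
    case False
    \<comment> \<open>The aim is the greatest match length \<open>m\<close> that occurs arbitrarily
      late; longer matches then all start before some bound \<open>C\<close>.\<close>
    define often where "often m \<longleftrightarrow> (\<forall>B. \<exists>j\<ge>B. occ m j)" for m
    have "often 0" using rec by (simp add: often_def occ_def recurrent_def)
    moreover have "\<not> often N" using False by (auto simp: often_def)
    ultimately obtain m where m: "often m" "\<not> often (Suc m)"
      by (metis nat_induct)
    then obtain C where C: "\<And>j. occ (Suc m) j \<Longrightarrow> j < C"
      unfolding often_def by (metis not_le)
    obtain D where D: "C \<le> D" "U D = x" using rec unfolding recurrent_def by blast
    \<comment> \<open>A power would put \<open>j - p\<close> below \<open>C\<close>, hence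
      \<open>D\<close> between \<open>j - p\<close> and \<open>j\<close>, which forces
      \<open>p\<close> to be at most \<open>D\<close>. Then \<open>j < C + D\<close>, against this
      choice of \<open>j\<close>.\<close>
    obtain j where j: "C + D + N \<le> j" "occ m j" using m unfolding often_def by blast
    have "pfree A (F j) M" for M
    proof (rule ccontr)
      assume "\<not> ?thesis"
      then obtain p where p: "p \<le> j" "occ (Suc m) (j - p)"
        "\<And>D. j - p < D \<Longrightarrow> D \<le> j \<Longrightarrow> U D = x \<Longrightarrow> p \<le> D"
        using crossing[OF j(2)] by metis
      then show False using C[OF p(2)] D j(1) p(1) p(3)[of D] by linarith
    qed
    then show thesis using finish[OF j(2)] j(1) by simp
  qed
qed

text \<open>The \<open>K\<close> letters before \<open>q\<close> read the same in \<open>F1\<close>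
  and in the reversed \<open>F2\<close>. Hence only a window covering this overlap, the position
  just before it and \<open>q\<close> could hold a new power.\<close>

lemma join:
  fixes T R F1 F2 :: "nat \<Rightarrow> 'a"
  assumes A: "\<And>\<beta>. exceeds A \<beta> \<Longrightarrow> 2 \<le> \<beta>"
    and Tx: "\<And>n. T n \<noteq> x"
    and F1: "\<And>M. pfree A F1 M" "F1 a = x" "\<And>n. F1 (a + 1 + n) = T n"
    and F2: "\<And>M. pfree A F2 M" "F2 c = x" "\<And>n. F2 (c + 1 + n) = R n"
    and K: "a + c < K" and e: "\<And>n. n < K \<Longrightarrow> T (e + n) = R (K - 1 - n)"
  defines "q \<equiv> a + 1 + e + K"
  defines "G \<equiv> \<lambda>n. if n < q then F1 n else F2 (q + c - n)"
  shows "pfree A G (q + c + 1)" and "\<And>n. a + e < n \<Longrightarrow> n \<le> q + c \<Longrightarrow> G n = F2 (q + c - n)"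
proof -
  show right: "G n = F2 (q + c - n)" if "a + e < n" "n \<le> q + c" for n
  proof (cases "n < q")
    case True
    define m where "m = n - (a + 1 + e)"
    have m: "n = a + 1 + (e + m)" "m < K" using that True by (auto simp: m_def q_def)
    have "G n = R (K - 1 - m)" using True F1(3)[of "e + m"] e m by (simp add: G_def)
    moreover have "q + c - n = c + 1 + (K - 1 - m)" using m by (simp add: q_def)
    ultimately show ?thesis by (simp only: F2(3))
  qed (simp add: G_def)
  have Gq: "G q = x" by (simp add: G_def F2(2))
  have Gx: "n \<le> a" if "n < q" "G n = x" for n
  proof (rule ccontr)
    assume "\<not> ?thesis"
    then have "G n = T (n - (a + 1))" using F1(3)[of "n - (a + 1)"] that by (simp add: G_def)
    then show False using that Tx[of "n - (a + 1)"] by metis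
  qed
  show "pfree A G (q + c + 1)"
    unfolding pfree_def
  proof (intro allI impI notI)
    fix i l p assume il: "i + l \<le> q + c + 1" and P: "power_at A G i l p"
    have p: "0 < p" "p \<le> l" using P by (auto simp: power_at_def)
    have "2 \<le> (of_nat l / of_nat p :: rat)" using P A unfolding power_at_def by blast
    then have "of_nat (2 * p) \<le> (of_nat l :: rat)" using p by (simp add: field_simps)
    then have l: "2 * p \<le> l" by (simp only: of_nat_le_iff)
    consider "i + l \<le> q" | "a + e < i" | "i \<le> a + e" "q < i + l" by linarith
    then show False
    proof cases
      case 1
      then have "power_at A F1 i l p" by (intro power_at_cong[OF P]) (auto simp: G_def)
      then show False using F1(1)[of "i + l"] unfolding pfree_def by blast
    next
      case 2
      then have "power_at A F2 (Suc (q + c) - i - l) l p"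
        using il by (intro power_at_reflect[OF P]) (auto intro!: right)
      then show False using F2(1)[of "Suc (q + c) - i - l + l"] unfolding pfree_def by blast
    next
      case 3
      show False
      \<comment> \<open>If \<open>q - p\<close> lies in the window, the \<open>x\<close> at
        \<open>q\<close> recurs there, so \<open>q - p\<close> is at most \<open>a\<close>, and two
        periods do not fit into \<open>q + c + 1\<close> positions. Otherwise the first period
        reaches beyond \<open>q\<close>, leaving at most \<open>c\<close> positions for the second,
        although \<open>p\<close> exceeds \<open>K\<close>.\<close>
      proof (cases "i + p \<le> q")
        case True
        then have "G (q - p) = G (q - p + p)"
          using P 3 p unfolding power_at_def by (auto simp del: le_add_diff_inverse2)
        then have "q - p \<le> a" using True Gq p by (intro Gx) auto
        then show False using il l K by (simp add: q_def)
      next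
        case False
        then show False using 3 il l K by (simp add: q_def)
      qed
    qed
  qed
qed

section \<open>Words avoiding a letter\<close>

fun thue_morse :: "nat \<Rightarrow> bool" where
  "thue_morse n = (if n = 0 then False else (thue_morse (n div 2) \<noteq> odd n))"

declare thue_morse.simps [simp del]

lemma thue_morse_even: "thue_morse (2 * n) = thue_morse n"
  by (subst thue_morse.simps) (auto simp: thue_morse.simps[of 0])

lemma thue_morse_odd: "thue_morse (Suc (2 * n)) = (\<not> thue_morse n)"
  by (subst thue_morse.simps) auto

text \<open>The letters at \<open>2 * m\<close> and \<open>Suc (2 * m)\<close> differ, so an equal
  pair straddles two such blocks.\<close>

lemma thue_morse_equal_adjacent:
  assumes "thue_morse n = thue_morse (Suc n)" shows "odd n"
proof
  assume "even n"
  then obtain m where "n = 2 * m" by blast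
  then show False using assms thue_morse_even[of m] thue_morse_odd[of m] by simp
qed

text \<open>For even \<open>p\<close>, the positions with the parity of \<open>i\<close> give an
  overlap of half the period. For odd \<open>p\<close>, equal neighbours would recur at the wrong
  parity, so the letters alternate from \<open>i\<close> to \<open>i + p\<close>, and the two ends
  differ.\<close>

lemma thue_morse_overlap_free:
  assumes "0 < p"
  shows "\<exists>n\<in>{i..i + p}. thue_morse n \<noteq> thue_morse (n + p)"
  using assms
proof (induction p arbitrary: i rule: less_induct)
  case (less p)
  show ?case
  proof (rule ccontr)
    assume "\<not> ?case"
    then have per: "thue_morse n = thue_morse (n + p)" if "i \<le> n" "n \<le> i + p" for n
      using that by auto
    show False
    proof (cases "even p")
      case True
      then obtain r where r: "p = 2 * r" by blast
      have "0 < r" "r < p" using r less.prems by auto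
      obtain n where n: "i div 2 \<le> n" "n \<le> i div 2 + r" "thue_morse n \<noteq> thue_morse (n + r)"
        using less.IH[OF \<open>r < p\<close> \<open>0 < r\<close>, of "i div 2"] by (meson atLeastAtMost_iff)
      show False
      proof (cases "even i")
        case True
        then have "thue_morse (2 * n) = thue_morse (2 * n + p)"
          using n r by (intro per) auto
        moreover have "2 * n + p = 2 * (n + r)" using r by simp
        ultimately show False using n(3) by (simp only: thue_morse_even)
      next
        case False
        then have "thue_morse (Suc (2 * n)) = thue_morse (Suc (2 * n) + p)"
          using n r by (intro per) (auto elim!: oddE)
        moreover have "Suc (2 * n) + p = Suc (2 * (n + r))" using r by simp
        ultimately show False using n(3) by (simp only: thue_morse_odd) blast
      qed
    next
      case False
      have flip: "thue_morse (Suc n) = (\<not> thue_morse n)" if "i \<le> n" "n < i + p" for n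
      proof (rule ccontr)
        assume "\<not> ?thesis"
        then have eq: "thue_morse n = thue_morse (Suc n)" by blast
        moreover have "thue_morse (n + p) = thue_morse (Suc (n + p))"
          using eq per[of n] per[of "Suc n"] that by simp
        ultimately have "odd n \<and> odd (n + p)"
          by (intro conjI thue_morse_equal_adjacent)
        then show False using False by simp
      qed
      have "thue_morse (i + m) = (thue_morse i = even m)" if "m \<le> p" for m
        using that by (induction m) (auto simp: flip)
      from this[of p] show False using per[of i] False by auto
    qed
  qed
qed

definition thue_diff :: "nat \<Rightarrow> int" where
  "thue_diff n = of_bool (thue_morse (Suc n)) - of_bool (thue_morse n)"

text \<open>Summation turns a square of differences into an overlap of the Thue--Morse word.\<close>

lemma thue_diff_square_free:
  assumes "0 < p"
  shows "\<exists>n\<in>{i..<i + p}. thue_diff n \<noteq> thue_diff (n + p)"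
proof (rule ccontr)
  assume "\<not> ?thesis"
  then have per: "thue_diff n = thue_diff (n + p)" if "i \<le> n" "n < i + p" for n
    using that by auto
  define d :: "nat \<Rightarrow> int"
    where "d n = of_bool (thue_morse (n + p)) - of_bool (thue_morse n)" for n
  have d: "d (i + m) = d i" if "m \<le> p" for m
    using that
  proof (induction m)
    case (Suc m)
    then show ?case using per[of "i + m"] by (simp add: thue_diff_def d_def)
  qed simp
  \<comment> \<open>The increments of the 0-1 word over both halves of the square agree, so they vanish.\<close>
  have "d i = 0" using d[of p]
    by (cases "thue_morse i"; cases "thue_morse (i + p)"; cases "thue_morse (i + p + p)")
      (auto simp: d_def)
  then have "d n = 0" if "n \<in> {i..i + p}" for n using d[of "n - i"] that by auto
  then have "thue_morse n = thue_morse (n + p)" if "n \<in> {i..i + p}" for n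
    using that by (fastforce simp: d_def of_bool_def split: if_splits)
  then show False using thue_morse_overlap_free[OF assms, of i] by blast
qed

lemma pfree_thue_morse:
  assumes "\<And>\<beta>. exceeds A \<beta> \<Longrightarrow> 2 < \<beta>" shows "pfree A thue_morse N"
  unfolding pfree_def
proof (intro allI impI notI)
  fix i l p assume P: "power_at A thue_morse i l p"
  have p: "0 < p" using P by (auto simp: power_at_def)
  have "2 < (of_nat l / of_nat p :: rat)" using P assms unfolding power_at_def by blast
  then have "of_nat (2 * p) < (of_nat l :: rat)" using p by (simp add: field_simps)
  then have "2 * p < l" by (simp only: of_nat_less_iff)
  then show False using P thue_morse_overlap_free[OF p, of i] unfolding power_at_def by auto
qed

lemma pfree_thue_diff:
  assumes "\<And>\<beta>. exceeds A \<beta> \<Longrightarrow> 2 \<le> \<beta>" shows "pfree A thue_diff N"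
  unfolding pfree_def
proof (intro allI impI notI)
  fix i l p assume P: "power_at A thue_diff i l p"
  have p: "0 < p" using P by (auto simp: power_at_def)
  have "2 \<le> (of_nat l / of_nat p :: rat)" using P assms unfolding power_at_def by blast
  then have "of_nat (2 * p) \<le> (of_nat l :: rat)" using p by (simp add: field_simps)
  then have "2 * p \<le> l" by (simp only: of_nat_le_iff)
  then show False using P thue_diff_square_free[OF p, of i] unfolding power_at_def by auto
qed

section \<open>Power free words avoiding a prescribed letter\<close>

lemma Upsilon_exceeds:
  assumes "(k, A) \<in> Upsilon" "exceeds A \<beta>"
  shows "2 \<le> \<beta>" and "k = 3 \<Longrightarrow> 2 < \<beta>"
  using assms by (cases A; auto simp: Upsilon_def exceeds_def split: if_splits)+

text \<open>One letter has to stay free. For \<open>k = 3\<close> two letters remain, and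
  overlap-freeness suffices because all forbidden exponents exceed 2; for larger \<open>k\<close> at
  least three remain, enough for a square free word.\<close>

lemma Upsilon_base_word:
  assumes "(k, A) \<in> Upsilon"
  obtains B :: "nat \<Rightarrow> nat" where "\<And>N. pfree A B N" "\<And>n. B n < k - 1"
proof (cases "k = 3")
  case True
  show thesis
  proof (rule that[of "of_bool \<circ> thue_morse"])
    show "pfree A (of_bool \<circ> thue_morse :: nat \<Rightarrow> nat) N" for N
      using Upsilon_exceeds(2)[OF assms] True
      by (intro pfree_inj_image pfree_thue_morse) (auto simp: inj_on_def)
  qed (use True in auto)
next
  case False
  then have "3 < k" using assms by (auto simp: Upsilon_def)
  show thesis
  proof (rule that[of "(\<lambda>z. nat (z + 1)) \<circ> thue_diff"])
    show "pfree A ((\<lambda>z. nat (z + 1)) \<circ> thue_diff) N" for N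
      using Upsilon_exceeds(1)[OF assms]
      by (intro pfree_inj_image pfree_thue_diff) (auto simp: inj_on_def thue_diff_def)
  qed (use \<open>3 < k\<close> in \<open>auto simp: thue_diff_def\<close>)
qed

lemma Upsilon_avoiding_word:
  assumes "(k, A) \<in> Upsilon" "x < k" "y < k" "y \<noteq> x"
  obtains T where "\<And>N. pfree A T N" "\<And>n. T n < k" "\<And>n. T n \<noteq> x" "recurrent y T"
proof -
  obtain B :: "nat \<Rightarrow> nat" where B: "\<And>N. pfree A B N" "\<And>n. B n < k - 1"
    using Upsilon_base_word[OF assms(1)] by metis
  obtain b where b: "b < k - 1" "recurrent b B" using ex_recurrent[of B, OF B(2)] by blast
  have "card {..<k - 1} = card ({..<k} - {x})" using assms(2) by simp
  then obtain g where g: "bij_betw g {..<k - 1} ({..<k} - {x})"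
    using finite_same_card_bij[of "{..<k - 1}" "{..<k} - {x}"] by blast
  \<comment> \<open>The bijection \<open>g\<close> skips \<open>x\<close>; the transposition makes
    \<open>y\<close> the image of the recurrent letter \<open>b\<close>.\<close>
  define h where "h = transpose (g b) y \<circ> g"
  have gm: "g m < k" "g m \<noteq> x" if "m < k - 1" for m using bij_betwE[OF g] that by blast+
  have hm: "h m < k" "h m \<noteq> x" if "m < k - 1" for m
    using gm[OF that] gm[OF b(1)] assms(3,4) by (simp_all add: h_def transpose_def)
  have "inj_on h {..<k - 1}"
    unfolding h_def
  proof (rule comp_inj_on)
    show "inj_on g {..<k - 1}" using g by (rule bij_betw_imp_inj_on)
    show "inj_on (transpose (g b) y) (g ` {..<k - 1})"
      by (rule inj_on_subset[OF inj_transpose subset_UNIV])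
  qed
  then have inj: "inj_on h (range B)" by (rule inj_on_subset) (use B(2) in auto)
  show thesis
  proof (rule that[of "h \<circ> B"])
    show "pfree A (h \<circ> B) N" for N using B(1) inj by (rule pfree_inj_image)
    show "recurrent y (h \<circ> B)"
      unfolding recurrent_def
    proof
      fix N
      obtain n where "N \<le> n" "B n = b" using b(2) unfolding recurrent_def by blast
      then show "\<exists>n\<ge>N. (h \<circ> B) n = y" by (intro exI[of _ n]) (simp add: h_def)
    qed
    show "(h \<circ> B) n < k" "(h \<circ> B) n \<noteq> x" for n using hm[OF B(2)] by simp_all
  qed
qed

section \<open>Assembling the connecting word\<close>

text \<open>If a recurrent letter \<open>x\<close> of \<open>U\<close> differs from
  \<open>y\<close>, grafting at \<open>x\<close> a word without \<open>x\<close> in which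
  \<open>y\<close> recurs makes \<open>y\<close> recurrent.\<close>

lemma common_recurrent_letter:
  assumes "(k, A) \<in> Upsilon" and U: "\<And>M. pfree A U M" "\<And>n. U n < k" and y: "y < k"
  obtains U' where "\<And>M. pfree A U' M" "\<And>n. U' n < k" "\<And>n. n < N \<Longrightarrow> U' n = U n" "recurrent y U'"
proof -
  obtain x where x: "x < k" "recurrent x U" using ex_recurrent[of U, OF U(2)] by blast
  show thesis
  proof (cases "x = y")
    case True
    show thesis by (rule that[of U]) (use U x True in auto)
  next
    case False
    then obtain T where T: "\<And>N. pfree A T N" "\<And>n. T n < k" "\<And>n. T n \<noteq> x" "recurrent y T"
      using Upsilon_avoiding_word[OF assms(1) x(1) y not_sym[OF False]] by metis
    obtain F a where F: "\<And>M. pfree A F M" "\<And>n. n < N \<Longrightarrow> F n = U n"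
      "F a = x" "\<And>n. F (a + 1 + n) = T n" "\<And>n. n \<le> a \<Longrightarrow> F n = U n"
      using graft[OF Upsilon_exceeds(1)[OF assms(1)] U(1) x(2) T(1,3), of N] by metis
    have tail: "F n = T (n - (a + 1))" if "a < n" for n using F(4)[of "n - (a + 1)"] that by simp
    show thesis
    proof (rule that[of F])
      show "F n < k" for n using F(5)[of n] tail[of n] U(2) T(2) by (cases "n \<le> a") auto
      show "recurrent y F"
        unfolding recurrent_def
      proof
        fix N obtain n where "N \<le> n" "T n = y" using T(4) unfolding recurrent_def by blast
        then show "\<exists>n\<ge>N. F n = y" using F(4)[of n] by (intro exI[of _ "a + 1 + n"]) auto
      qed
    qed (use F in auto)
  qed
qed

theorem mainTheorem1:
  assumes "(k, A) \<in> Upsilon"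
    and "u \<in> rext (L k A)"
    and "v \<in> lext (L k A)"
  shows "\<exists>w \<in> L k A. u @ w @ v \<in> L k A"
proof -
  note A = Upsilon_exceeds(1)[OF assms(1)]
  obtain U where U: "\<And>n. U n < k" "\<And>N. pfree A U N" "\<And>n. n < length u \<Longrightarrow> U n = u ! n"
    using infinite_extension[OF assms(2)] by metis
  obtain V where V: "\<And>n. V n < k" "\<And>N. pfree A V N"
      "\<And>n. n < length (rev v) \<Longrightarrow> V n = rev v ! n"
    using infinite_extension[OF rev_mem_rext[OF assms(3)]] by metis
  obtain x where x: "x < k" "recurrent x V" using ex_recurrent[of V, OF V(1)] by blast
  obtain U' where U': "\<And>M. pfree A U' M" "\<And>n. U' n < k"
      "\<And>n. n < length u \<Longrightarrow> U' n = U n" "recurrent x U'"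
    using common_recurrent_letter[OF assms(1) U(2,1) x(1), of "length u"] by metis
  have "3 \<le> k" using assms(1) by (auto simp: Upsilon_def)
  then obtain y where y: "y < k" "y \<noteq> x"
    using that[of "if x = 0 then 1 else 0"] by (auto split: if_splits)
  obtain T where T: "\<And>N. pfree A T N" "\<And>n. T n < k" "\<And>n. T n \<noteq> x"
    using Upsilon_avoiding_word[OF assms(1) x(1) y] by metis
  obtain R where R: "\<And>K. \<exists>e. \<forall>n<K. T (e + n) = R (K - 1 - n)"
    using reversed_limit_word[of T, OF T(2)] by metis
  have R_T: "\<exists>m. R n = T m" for n
  proof -
    obtain e where "\<forall>i<Suc n. T (e + i) = R (Suc n - 1 - i)" using R by blast
    from this[rule_format, of 0] have "R n = T e" by simp
    then show ?thesis by blast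
  qed
  \<comment> \<open>As \<open>R\<close> avoids \<open>x\<close> and is power free, it can be grafted
    onto \<open>V\<close> at the same letter as \<open>T\<close> onto \<open>U'\<close>.\<close>
  have Rx: "R n \<noteq> x" for n using R_T[of n] T(3) by metis
  have Rf: "pfree A R M" for M
    unfolding pfree_def
  proof (intro allI impI notI)
    fix i l p assume il: "i + l \<le> M" and P: "power_at A R i l p"
    obtain e where e: "\<And>n. n < M \<Longrightarrow> T (e + n) = R (M - 1 - n)" using R by blast
    have "0 < l" using P by (auto simp: power_at_def)
    have "power_at A T (Suc (e + M - 1) - i - l) l p"
    proof (rule power_at_reflect[OF P])
      show "R n = T (e + M - 1 - n)" if "i \<le> n" "n < i + l" for n
        using e[of "M - 1 - n"] that il by (simp add: algebra_simps)
    qed (use il \<open>0 < l\<close> in auto)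
    then show False using T(1)[of "Suc (e + M - 1) - i - l + l"] unfolding pfree_def by blast
  qed
  obtain F1 a where F1: "\<And>M. pfree A F1 M" "\<And>n. n < length u \<Longrightarrow> F1 n = U' n"
      "F1 a = x" "\<And>n. F1 (a + 1 + n) = T n" "\<And>n. n \<le> a \<Longrightarrow> F1 n = U' n"
    using graft[OF A U'(1,4) T(1,3), of "length u"] by metis
  obtain F2 c where F2: "\<And>M. pfree A F2 M" "\<And>n. n < length v \<Longrightarrow> F2 n = V n"
      "F2 c = x" "\<And>n. F2 (c + 1 + n) = R n" "\<And>n. n \<le> c \<Longrightarrow> F2 n = V n"
    using graft[OF A V(2) x(2) Rf Rx, of "length v"] by metis
  \<comment> \<open>The summand \<open>a + c + 1\<close> meets the bound in \<open>join\<close>; the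
    two lengths place \<open>u\<close> before \<open>q\<close> and \<open>v\<close> within the range
    read from \<open>F2\<close>, without overlap.\<close>
  define K where "K = a + c + 1 + length u + length v"
  obtain e where e: "\<And>n. n < K \<Longrightarrow> T (e + n) = R (K - 1 - n)" using R by blast
  define q where "q = a + 1 + e + K"
  define G where "G n = (if n < q then F1 n else F2 (q + c - n))" for n
  have "a + c < K" by (simp add: K_def)
  note J = join[OF A T(3) F1(1,3,4) F2(1,3,4) this e, folded q_def, folded G_def]
  define S where "S = q + c + 1"
  have S: "length u + length v \<le> S" by (simp add: S_def q_def K_def)
  have "G n < k" for n
  proof (cases "n < q")
    case True
    then show ?thesis using F1(5)[of n] F1(4)[of "n - (a + 1)"] U'(2) T(2)
      by (cases "n \<le> a") (auto simp: G_def)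
  next
    case False
    then show ?thesis using F2(5)[of "q + c - n"] V(1) by (simp add: G_def)
  qed
  then have W: "map G [0..<S] \<in> L k A"
    unfolding map_upt_mem_L_iff using J(1) by (simp add: S_def)
  define w where "w = map G [length u..<S - length v]"
  have "map G [0..<length u] = u"
    using F1(2) U'(3) U(3) by (intro nth_equalityI) (auto simp: G_def q_def K_def)
  moreover have "map G [S - length v..<S] = v"
  proof (rule nth_equalityI)
    fix n assume "n < length (map G [S - length v..<S])"
    then have n: "n < length v" using S by simp
    have "G (S - length v + n) = F2 (q + c - (S - length v + n))"
      using n S by (intro J(2)) (auto simp: S_def q_def K_def)
    also have "q + c - (S - length v + n) = length v - 1 - n" using n S by (simp add: S_def)
    also have "F2 \<dots> = v ! n" using n F2(2)[of "length v - 1 - n"] V(3)[of "length v - 1 - n"] by (simp add: rev_nth)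
    finally show "map G [S - length v..<S] ! n = v ! n" using n S by simp
  qed (use S in auto)
  moreover have "[0..<S] = [0..<length u] @ [length u..<S - length v] @ [S - length v..<S]"
    using S upt_add_eq_append[of 0 "length u" "S - length u"]
      upt_add_eq_append[of "length u" "S - length v" "length v"] by simp
  ultimately have "map G [0..<S] = u @ w @ v" by (simp add: w_def)
  then have "u @ w @ v \<in> L k A" using W by simp
  then show ?thesis using factor_mem_L by blast
qed

end
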